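(* Assume the ABC conjecture. If $a,q,\ell$ are positive integers such that the arithmetic progression $\{a+jq:0\le j\le\ell-1\}$ is contained in the set of perfect powers, then $$\ell\ll\frac{\log\log a}{\log\log\log a},$$ where the implied constant is absolute.
   Context: A perfect power is an integer of the form $x^m$ with $x,m$ positive integers and $m\ge2$. The ABC conjecture: for each $\varepsilon>0$ there is a constant $K_\varepsilon$ such that whenever $a,b,c$ are nonzero integers with $\gcd(a,b,c)=1$ and $a+b=c$, we have $\max\{|a|,|b|,|c|\}\le K_\varepsilon\operatorname{rad}(abc)^{1+\varepsilon}$, where $\operatorname{rad}(n)=\prod_{p\mid n}p$.
   Formalization: The bound is stated for a > e^e (that is, a ≥ 16), the range where log log a / log log log a is defined and positive; for smaller positive a the right-hand side is undefined or negative. *)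

theory Defs
  imports Complex_Main "HOL-Computational_Algebra.Primes"
begin

definition perfect_powers :: "nat set" where
  "perfect_powers = {x ^ m | x m. x > 0 \<and> m \<ge> 2}"

definition rad :: "int \<Rightarrow> int" where
  "rad n = \<Prod>(prime_factors n)"

definition ABC_conjecture :: bool where
  "ABC_conjecture \<longleftrightarrow>
     (\<forall>\<epsilon>::real. \<epsilon> > 0 \<longrightarrow>
       (\<exists>K::real. \<forall>a b c::int.
          a \<noteq> 0 \<longrightarrow> b \<noteq> 0 \<longrightarrow> c \<noteq> 0 \<longrightarrow> Gcd {a, b, c} = 1 \<longrightarrow> a + b = c \<longrightarrow>
          real_of_int (Max {\<bar>a\<bar>, \<bar>b\<bar>, \<bar>c\<bar>}) \<le> K * real_of_int (rad (a * b * c)) powr (1 + \<epsilon>)))"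

end

theory Submission
  imports Defs "HOL-Number_Theory.Cong" "HOL-Real_Asymp.Real_Asymp"
begin

text \<open>
  Write \<open>g = gcd a q\<close>, \<open>a = g A\<close>, \<open>q = g Q\<close> and \<open>t j = A + j Q\<close>, and let \<open>r j\<close> be a prime such that
  \<open>g * t j\<close> is an \<open>r j\<close>-th power. If \<open>r i = r j\<close>, then a prime dividing \<open>t i\<close> exactly once also divides
  \<open>t j\<close>, hence \<open>i - j\<close>, so the radical of \<open>t i\<close> is at most \<open>sqrt (\<bar>i - j\<bar> * t i)\<close>. By the ABC conjecture,
  seven consecutive terms with radicals at most \<open>sqrt (M * t i)\<close> are bounded by \<open>K M^12\<close>.

  Suppose that fewer than \<open>l / 100\<close> distinct exponents occur. Some seven consecutive indices then all
  share their exponents with other indices, so all \<open>t j\<close> are polynomially bounded in \<open>l\<close>. An exponent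
  \<open>r\<close> that occurs twice satisfies \<open>2^r \<le> t l\<close>, so only \<open>O(log l)\<close> exponents repeat. Therefore
  most indices share their exponent with an index at distance \<open>O(log l)\<close>, and the ABC bound, applied to a
  window in the second half of the progression, gives \<open>l / 2 \<le> K (O(log l))^12\<close>, so \<open>l\<close> is bounded.

  Suppose that at least \<open>l / 100\<close> distinct exponents occur. If \<open>g\<close> has a prime factor \<open>p > 1000\<close>, then \<open>p\<close>
  divides few of the \<open>t j\<close>, and for the others \<open>r j\<close> divides the multiplicity of \<open>p\<close> in \<open>g\<close>. That
  multiplicity is divisible by a product of many distinct primes, hence at least \<open>(c l)!\<close>, and
  \<open>a \<ge> 2^((c l)!)\<close>. If \<open>g\<close> has no such factor, the radicals of the \<open>t j\<close> are at most \<open>sqrt (1000! * t j)\<close>,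
  so \<open>Q\<close> is bounded, whereas every prime up to \<open>l / 2\<close> divides \<open>g Q\<close>.
\<close>

section \<open>Radicals of natural numbers and the ABC conjecture for them\<close>

definition radical :: "nat \<Rightarrow> nat" where
  "radical n = \<Prod>(prime_factors n)"

lemma radical_pos: "radical n > 0"
  unfolding radical_def by (intro prod_pos) (auto dest: in_prime_factors_imp_prime prime_gt_0_nat)

lemma rad_int: "rad (int n) = int (radical n)"
proof -
  have "prime_factors (int n) = int ` prime_factors n"
  proof (cases "n = 0")
    case False
    show ?thesis
    proof (intro equalityI subsetI)
      fix x assume "x \<in> prime_factors (int n)"
      then have x: "prime x" "x dvd int n" by auto
      then obtain m where "x = int m" using prime_ge_0_int zero_le_imp_eq_int by blast
      with x False show "x \<in> int ` prime_factors n"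
        by (auto simp: in_prime_factors_iff)
    next
      fix x assume "x \<in> int ` prime_factors n"
      with False show "x \<in> prime_factors (int n)"
        by (auto simp: in_prime_factors_iff)
    qed
  qed simp
  then show ?thesis
    by (simp add: rad_def radical_def prod.reindex)
qed

lemma multiplicity_radical:
  assumes "n > 0" "prime p"
  shows "multiplicity p (radical n) = (if p dvd n then 1 else 0)"
proof -
  have "multiplicity p (radical n) = (\<Sum>x\<in>prime_factors n. multiplicity p x)"
    unfolding radical_def using assms
    by (subst prime_elem_multiplicity_prod_distrib) auto
  also have "\<dots> = (\<Sum>x\<in>prime_factors n. if x = p then 1 else 0)"
    using assms by (intro sum.cong) (auto intro!: prime_multiplicity_other dest: in_prime_factors_imp_prime)
  also have "\<dots> = (if p dvd n then 1 else 0)"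
    using assms by (simp add: in_prime_factors_iff)
  finally show ?thesis .
qed

lemma radical_dvdI:
  assumes "n > 0" "m > 0" "\<And>p. prime p \<Longrightarrow> p dvd n \<Longrightarrow> p dvd m"
  shows "radical n dvd m"
proof (rule multiplicity_le_imp_dvd)
  fix p :: nat assume p: "prime p"
  show "multiplicity p (radical n) \<le> multiplicity p m"
    using assms p by (auto simp: multiplicity_radical Suc_le_eq prime_multiplicity_gt_zero_iff)
qed (use radical_pos[of n] in simp)

lemma prime_dvd_radical:
  assumes "n > 0" "prime p" "p dvd n"
  shows "p dvd radical n"
proof (rule ccontr)
  assume "\<not> p dvd radical n"
  then have "multiplicity p (radical n) = 0" by (rule not_dvd_imp_multiplicity_0)
  with assms show False by (simp add: multiplicity_radical)
qed

text \<open>Prime by prime, the left side has multiplicity 2 at each prime factor of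
  \<open>t\<close>. A factor that occurs in \<open>t\<close> at least twice already pays for this;
  one that occurs once needs a further \<open>p\<close> from \<open>d\<close>.\<close>

lemma radical_square_le:
  assumes "t > 0" "d > 0" and "\<And>p. prime p \<Longrightarrow> multiplicity p t = 1 \<Longrightarrow> p dvd d"
  shows "radical t ^ 2 \<le> d * t"
proof (rule dvd_imp_le)
  show "radical t ^ 2 dvd d * t"
  proof (rule multiplicity_le_imp_dvd)
    fix p :: nat assume p: "prime p"
    have "multiplicity p (radical t ^ 2) = 2 * multiplicity p (radical t)"
      using p radical_pos[of t] by (simp add: prime_elem_multiplicity_power_distrib)
    also have "\<dots> \<le> multiplicity p d + multiplicity p t"
    proof (cases "p dvd t")
      case True
      then have "multiplicity p t \<ge> 1"
        using p assms by (simp add: Suc_le_eq prime_multiplicity_gt_zero_iff)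
      moreover have "multiplicity p d \<ge> 1" if "multiplicity p t = 1"
        using assms(2) assms(3)[OF p that] p by (simp add: Suc_le_eq prime_multiplicity_gt_zero_iff)
      ultimately show ?thesis
        using True p assms by (cases "multiplicity p t = 1") (auto simp: multiplicity_radical)
    qed (use p assms in \<open>simp add: multiplicity_radical\<close>)
    also have "\<dots> = multiplicity p (d * t)"
      using p assms by (simp add: prime_elem_multiplicity_mult_distrib)
    finally show "multiplicity p (radical t ^ 2) \<le> multiplicity p (d * t)" .
  qed (use radical_pos[of t] in simp)
qed (use assms in simp)

text \<open>Dividing \<open>a\<close> and \<open>b\<close> by their gcd gives a coprime triple whose
  radical divides the original one. Scaling back costs the factor \<open>D\<close>.\<close>

lemma ABC_conjecture_nat:
  assumes "ABC_conjecture" "\<epsilon> > 0"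
  obtains K :: real where "K > 0"
    "\<And>a b D. a > 0 \<Longrightarrow> b > 0 \<Longrightarrow> gcd a b \<le> D \<Longrightarrow>
       real (a + b) \<le> K * D * real (radical (a * b * (a + b))) powr (1 + \<epsilon>)"
proof -
  obtain K where K: "\<forall>a b c::int. a \<noteq> 0 \<longrightarrow> b \<noteq> 0 \<longrightarrow> c \<noteq> 0 \<longrightarrow> Gcd {a, b, c} = 1 \<longrightarrow>
      a + b = c \<longrightarrow>
      real_of_int (Max {\<bar>a\<bar>, \<bar>b\<bar>, \<bar>c\<bar>}) \<le> K * real_of_int (rad (a * b * c)) powr (1 + \<epsilon>)"
    using assms(1)[unfolded ABC_conjecture_def, THEN spec, THEN mp, OF assms(2)] by (elim exE)
  show ?thesis
  proof (rule that[of "max K 1"])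
    fix a b D :: nat
    assume a: "a > 0" and b: "b > 0" and D: "gcd a b \<le> D"
    define g where "g = gcd a b"
    have g: "g > 0" using a by (simp add: g_def)
    obtain u v where "a = u * g" "b = v * g" and cop: "coprime u v"
      using gcd_coprime_exists[of a b] g unfolding g_def by auto
    then have uv: "a = g * u" "b = g * v" by simp_all
    have pos: "u > 0" "v > 0" using a b uv by auto
    have gcd1: "Gcd {int u, int v, int (u + v)} = 1"
    proof -
      have "coprime (int u) (int v)"
        using cop by (simp only: coprime_int_iff)
      moreover have "Gcd {int u, int v, int (u + v)} dvd int u" "Gcd {int u, int v, int (u + v)} dvd int v"
        by (rule Gcd_dvd, simp)+
      ultimately have "is_unit (Gcd {int u, int v, int (u + v)})"
        by (rule coprime_common_divisor)
      then show ?thesis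
        using is_unit_normalize normalize_Gcd by metis
    qed
    have "real (u + v) \<le> real_of_int (Max {\<bar>int u\<bar>, \<bar>int v\<bar>, \<bar>int (u + v)\<bar>})"
      by (subst of_int_of_nat_eq[symmetric], subst of_int_le_iff, rule Max_ge) simp_all
    also have "\<dots> \<le> K * real_of_int (rad (int u * int v * int (u + v))) powr (1 + \<epsilon>)"
      by (rule K[rule_format, OF _ _ _ gcd1]) (use pos in simp_all)
    also have "\<dots> = K * real (radical (u * v * (u + v))) powr (1 + \<epsilon>)"
      by (simp only: of_nat_mult[symmetric] rad_int of_int_of_nat_eq)
    also have "\<dots> \<le>
               max K 1 * real (radical (a * b * (a + b))) powr (1 + \<epsilon>)"
    proof (intro mult_mono powr_mono2)
      have "u * v * (u + v) dvd a * b * (a + b)"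
        unfolding uv distrib_left[symmetric] by (intro mult_dvd_mono dvd_triv_right)
      then have "radical (u * v * (u + v)) dvd radical (a * b * (a + b))"
        using pos a b by (intro radical_dvdI radical_pos prime_dvd_radical) (auto dest: dvd_trans)
      then show "real (radical (u * v * (u + v))) \<le> real (radical (a * b * (a + b)))"
        by (simp add: dvd_imp_le radical_pos)
    qed (use assms(2) in auto)
    finally have le: "real (u + v) \<le> max K 1 * real (radical (a * b * (a + b))) powr (1 + \<epsilon>)" .
    have "real (a + b) = real g * real (u + v)"
      by (simp add: uv algebra_simps)
    also have "\<dots> \<le> real D * (max K 1 * real (radical (a * b * (a + b))) powr (1 + \<epsilon>))"
      using le D by (intro mult_mono) (auto simp: g_def)
    finally show "real (a + b) \<le> max K 1 * D * real (radical (a * b * (a + b))) powr (1 + \<epsilon>)"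
      by (simp only: mult_ac)
  qed auto
qed

section \<open>Coprime arithmetic progressions and the ABC bound on seven terms\<close>

lemma coprime_progression:
  fixes A Q j :: nat
  assumes "coprime A Q"
  shows "coprime (A + j * Q) Q"
  using assms gcd_add_mult[of Q j A] by (simp only: coprime_iff_gcd_eq_1 gcd.commute[of _ Q] add.commute)

lemma prime_dvd_progression_diff:
  fixes A Q i j p :: nat
  assumes "coprime A Q" "prime p" "p dvd A + i * Q" "p dvd A + j * Q"
  shows "p dvd nat \<bar>int i - int j\<bar>"
proof -
  have "int p dvd int (A + i * Q) - int (A + j * Q)"
    using assms(3,4) by (intro dvd_diff) (simp_all only: of_nat_dvd_iff)
  also have "int (A + i * Q) - int (A + j * Q) = (int i - int j) * int Q"
    by (simp add: algebra_simps)
  finally have "int p dvd int i - int j \<or> int p dvd int Q"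
    using assms(2) by (simp add: prime_dvd_mult_iff)
  moreover have "\<not> p dvd Q"
    using coprime_common_divisor[OF coprime_progression[OF assms(1)] assms(3)] assms(2) not_prime_unit
    by blast
  ultimately have "int p dvd \<bar>int i - int j\<bar>" by simp
  then show ?thesis by (simp add: nat_dvd_iff int_dvd_int_iff[symmetric] del: int_dvd_int_iff)
qed

text \<open>
  The identity behind this is \<open>(x - 1)^3 (x + 3) - (x + 1)^3 (x - 3) = 16 x\<close>, homogenised with
  \<open>x = a + 3 q\<close>: it has degree 4 but only five linear factors besides \<open>q\<close>, so terms whose radicals
  are about their square roots make the radical too small, \<open>N^(5/2 + 1)\<close> against \<open>N^4\<close>.
\<close>
lemma ABC_five_terms:
  assumes "ABC_conjecture"
  obtains K :: real where "K \<ge> 1"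
    "\<And>a q M :: nat. a > 0 \<Longrightarrow> q > 0 \<Longrightarrow> coprime a q \<Longrightarrow> M > 0 \<Longrightarrow>
       \<forall>j\<le>6. radical (a + j * q) ^ 2 \<le> M * (a + j * q) \<Longrightarrow>
       real (a + 6 * q) \<le> K * real M ^ 12"
proof -
  \<comment> \<open>The radical will be at most a constant times M^(5/2) N^(7/2). With epsilon =
    1/14 the power of N becomes 7/2 * 15/14 = 15/4, which is below 4.\<close>
  obtain K :: real where K: "K > 0"
    "\<And>a b D. a > 0 \<Longrightarrow> b > 0 \<Longrightarrow> gcd a b \<le> D \<Longrightarrow>
       real (a + b) \<le> K * D * real (radical (a * b * (a + b))) powr (1 + 1/14)"
    using ABC_conjecture_nat[OF assms, of "1/14"] by auto
  show ?thesis
  proof (rule that[of "max 1 ((5184 * K) ^ 4)"])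
    fix a q M :: nat
    assume a: "a > 0" and q: "q > 0" and cop: "coprime a q" and M: "M > 0"
      and rad: "\<forall>j\<le>6. radical (a + j * q) ^ 2 \<le> M * (a + j * q)"
    define T where "T j = a + j * q" for j
    define u where "u = T 4 ^ 3 * T 0"
    define v where "v = 16 * T 3 * q ^ 3"
    have Tpos: "T j > 0" for j using a by (simp add: T_def)
    have pos: "u > 0" "v > 0" using Tpos q by (simp_all add: u_def v_def)
    have sum: "u + v = T 2 ^ 3 * T 6"
      unfolding u_def v_def T_def by (simp add: algebra_simps power3_eq_cube)
    have copq: "coprime (T j) q" for j
      unfolding T_def using cop by (rule coprime_progression)
    \<comment> \<open>All terms are coprime to \<open>q\<close>, so the gcd divides 16 *
      \<open>T 3\<close>. As \<open>T 3\<close> is coprime to \<open>T 4\<close> and shares with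
      \<open>T 0\<close> at most a factor 3, it divides 16 * 3.\<close>
    have "gcd u v dvd 48"
    proof -
      let ?d = "gcd u v"
      have "coprime u q" using copq by (simp add: u_def)
      then have "coprime ?d (q ^ 3)"
        using coprime_divisors[of ?d u q q] by simp
      then have d1: "?d dvd 16 * T 3"
        using gcd_dvd2[of u v] coprime_dvd_mult_left_iff v_def by metis
      have "coprime (T 3) (T 4)"
      proof -
        have "T 4 = T 3 + q" by (simp add: T_def)
        then show ?thesis using copq[of 3] by (simp add: coprime_iff_gcd_eq_1)
      qed
      then have "gcd (T 3) u = gcd (T 3) (T 0)"
        by (simp add: u_def gcd_mult_left_left_cancel gcd_mult_right_left_cancel coprime_commute)
      also have "\<dots> dvd 3"
      proof -
        have eq: "T 3 = T 0 + 3 * q" by (simp add: T_def)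
        have "gcd (T 3) (T 0) dvd T 3" "gcd (T 3) (T 0) dvd T 0" by simp_all
        then have "gcd (T 3) (T 0) dvd 3 * q" unfolding eq by (simp only: dvd_add_right_iff)
        moreover have "coprime (gcd (T 3) (T 0)) q"
          using copq[of 0] coprime_divisors[of "gcd (T 3) (T 0)" "T 0" q q] by simp
        ultimately show ?thesis by (simp add: coprime_dvd_mult_left_iff)
      qed
      finally have "gcd (T 3) u dvd 3" .
      moreover have "?d dvd 16 * gcd (T 3) u"
        using d1 by (simp add: gcd_mult_distrib_nat)
      ultimately have "?d dvd 16 * 3"
        by (meson dvd_trans dvd_refl mult_dvd_mono)
      then show ?thesis by simp
    qed
    then have D: "gcd u v \<le> 48" by (rule dvd_imp_le) simp
    define N where "N = T 6"
    define P where "P = radical (T 0) * radical (T 2) * radical (T 3) * radical (T 4) * radical (T 6)"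
    have Ppos: "P > 0" by (simp add: P_def radical_pos)
    have TN: "T j \<le> N" if "j \<le> 6" for j using that by (simp add: N_def T_def)
    have R: "radical (u * v * (u + v)) \<le> 2 * P * q"
    proof (rule dvd_imp_le)
      show "radical (u * v * (u + v)) dvd 2 * P * q"
      proof (rule radical_dvdI)
        fix p :: nat assume p: "prime p" "p dvd u * v * (u + v)"
        have *: "p dvd radical (T j)" if "p dvd T j" for j
          using prime_dvd_radical[OF Tpos p(1) that] .
        have "p dvd 2" if "p dvd 16"
        proof -
          have "p dvd 2 ^ 4" using that by simp
          then show ?thesis using p(1) prime_dvd_power by blast
        qed
        moreover have "p dvd u * v * (T 2 ^ 3 * T 6)" using p(2) by (simp only: sum)
        ultimately show "p dvd 2 * P * q"
          using p(1) * unfolding u_def v_def P_def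
          by (auto simp: prime_dvd_mult_iff prime_dvd_power_iff)
      qed (use pos q Ppos in auto)
    qed (use q Ppos in auto)
    have P2: "P ^ 2 \<le> M ^ 5 * N ^ 5"
    proof -
      have r: "radical (T j) ^ 2 \<le> M * N" if "j \<le> 6" for j
      proof -
        have "radical (T j) ^ 2 \<le> M * T j" using rad that by (simp add: T_def)
        also have "\<dots> \<le> M * N" using TN[OF that] by simp
        finally show ?thesis .
      qed
      have "P ^ 2 = radical (T 0) ^ 2 * radical (T 2) ^ 2 * radical (T 3) ^ 2 * radical (T 4) ^ 2 * radical (T 6) ^ 2"
        by (simp add: P_def power_mult_distrib)
      also have "\<dots> \<le> (M * N) * (M * N) * (M * N) * (M * N) * (M * N)"
        by (intro mult_mono r) auto
      also have "\<dots> = M ^ 5 * N ^ 5" by (simp add: eval_nat_numeral)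
      finally show ?thesis .
    qed
    have Npos: "N > 0" using Tpos by (simp add: N_def)
    have "q \<le> N" by (simp add: N_def T_def)
    then have "(2 * P * q) ^ 2 \<le> 4 * (M ^ 5 * N ^ 5) * N ^ 2"
      unfolding power_mult_distrib using P2 by (intro mult_mono power_mono) auto
    also have "\<dots> = 4 * M ^ 5 * N ^ 7" by (simp add: mult.assoc flip: power_add)
    finally have "real ((2 * P * q) ^ 2) \<le> real (4 * M ^ 5 * N ^ 7)"
      by (simp only: of_nat_le_iff)
    then have R2: "real (2 * P * q) ^ 2 \<le> 4 * real M ^ 5 * real N ^ 7"
      by simp
    have "real (2 * P * q) powr (15/14) = (real (2 * P * q) ^ 2) powr (15/28)"
      by (simp add: powr_powr flip: powr_numeral)
    also have "\<dots> \<le> (4 * real M ^ 5 * real N ^ 7) powr (15/28)"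
      using R2 by (intro powr_mono2) auto
    also have "\<dots> = 4 powr (15/28) * real M powr (75/28) * real N powr (15/4)"
      using M Npos by (simp add: powr_mult powr_powr flip: powr_numeral)
    also have "\<dots> \<le> 4 powr 1 * real M powr 3 * real N powr (15/4)"
      using M Npos by (intro mult_mono powr_mono) auto
    finally have Rb: "real (2 * P * q) powr (15/14) \<le> 4 * real M ^ 3 * real N powr (15/4)"
      using M by simp
    \<comment> \<open>This bounds the sum \<open>T 2 ^ 3 * T 6\<close> below by N^4 / 27. The
      constant 5184 is then 27 * 48 * 4.\<close>
    have "N \<le> 3 * T 2" by (simp add: N_def T_def)
    then have "N ^ 3 * N \<le> (3 * T 2) ^ 3 * N" by (intro mult_mono power_mono) auto
    also have "\<dots> = 27 * (u + v)" by (simp add: sum N_def power_mult_distrib)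
    finally have "real (N ^ 3 * N) \<le> 27 * real (u + v)"
      using of_nat_le_iff[where ?'a = real, of "N ^ 3 * N" "27 * (u + v)"] by simp
    moreover have "N ^ 3 * N = N ^ 4" by (simp add: eval_nat_numeral)
    ultimately have "real N ^ 4 \<le> 27 * real (u + v)" by simp
    also have "\<dots> \<le> 27 * (K * 48 * real (radical (u * v * (u + v))) powr (1 + 1/14))"
      using K(2)[OF pos D] by simp
    also have "\<dots> \<le> 27 * (K * 48 * real (2 * P * q) powr (15/14))"
      using K(1) of_nat_mono[OF R, where ?'a = real] by (auto intro!: powr_mono2)
    also have "\<dots> \<le> 27 * (K * 48 * (4 * real M ^ 3 * real N powr (15/4)))"
      using K(1) Rb by simp
    finally have "real N ^ 4 \<le> (5184 * K * real M ^ 3) * real N powr (15/4)"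
      by (simp add: mult_ac)
    \<comment> \<open>Cancelling N^(15/4) leaves N^(1/4), and the fourth power turns M^3 into
      M^12.\<close>
    moreover have "real N ^ 4 = real N powr (1/4) * real N powr (15/4)"
      using Npos by (simp flip: powr_add powr_numeral)
    ultimately have "real N powr (1/4) \<le> 5184 * K * real M ^ 3"
      using Npos by simp
    then have "(real N powr (1/4)) ^ 4 \<le> (5184 * K * real M ^ 3) ^ 4"
      by (intro power_mono) auto
    also have "(real N powr (1/4)) ^ 4 = real N"
      using Npos by (simp add: powr_powr flip: powr_numeral)
    also have "(5184 * K * real M ^ 3) ^ 4 = (5184 * K) ^ 4 * real M ^ 12"
      by (simp add: power_mult_distrib flip: power_mult)
    also have "\<dots> \<le> max 1 ((5184 * K) ^ 4) * real M ^ 12"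
      by (intro mult_right_mono) auto
    finally show "real (a + 6 * q) \<le> max 1 ((5184 * K) ^ 4) * real M ^ 12"
      by (simp add: N_def T_def)
  qed auto
qed

text \<open>Two indices of multiples of \<open>p\<close> differ by a multiple of \<open>p\<close>,
  so each block of \<open>p\<close> consecutive indices holds at most one.\<close>

lemma card_prime_dvd_progression:
  fixes A Q p :: nat
  assumes "coprime A Q" "prime p"
  shows "card {j. j < l \<and> p dvd A + j * Q} \<le> l div p + 1"
proof -
  have "inj_on (\<lambda>j. j div p) {j. j < l \<and> p dvd A + j * Q}"
  proof (rule inj_onI)
    fix i j assume i: "i \<in> {j. j < l \<and> p dvd A + j * Q}" and j: "j \<in> {j. j < l \<and> p dvd A + j * Q}"
      and eq: "i div p = j div p"
    then have "p dvd nat \<bar>int i - int j\<bar>"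
      using assms by (intro prime_dvd_progression_diff) auto
    moreover have "\<bar>int i - int j\<bar> < int p"
    proof -
      have "i = p * (j div p) + i mod p" "j = p * (j div p) + j mod p"
        using eq mult_div_mod_eq[of p i] mult_div_mod_eq[of p j] by simp_all
      moreover have "i mod p < p" "j mod p < p"
        using assms(2) by (simp_all add: prime_gt_0_nat)
      ultimately show ?thesis by linarith
    qed
    ultimately have "nat \<bar>int i - int j\<bar> = 0"
      using nat_dvd_not_less[of "nat \<bar>int i - int j\<bar>" p] by linarith
    then show "i = j" by simp
  qed
  moreover have "(\<lambda>j. j div p) ` {j. j < l \<and> p dvd A + j * Q} \<subseteq> {..l div p}"
    by (auto intro: div_le_mono)
  ultimately have "card {j. j < l \<and> p dvd A + j * Q} \<le> card {..l div p}"
    by (intro card_inj_on_le) auto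
  then show ?thesis by simp
qed

section \<open>Lower bounds for products of distinct numbers\<close>

text \<open>The maximum of a set of positive integers is at least its cardinality; removing it gives
  the induction.\<close>

lemma fact_card_le_prod:
  fixes E :: "nat set"
  assumes "finite E" "0 \<notin> E"
  shows "fact (card E) \<le> \<Prod>E"
  using assms
proof (induction "card E" arbitrary: E)
  case 0
  then show ?case by simp
next
  case (Suc n)
  then have ne: "E \<noteq> {}" by auto
  define m where "m = Max E"
  have m: "m \<in> E" using ne Suc.prems by (simp add: m_def)
  have "E \<subseteq> {1..m}"
  proof
    fix x assume x: "x \<in> E"
    then have "x \<noteq> 0" using Suc.prems(2) by metis
    with x show "x \<in> {1..m}" using Suc.prems(1) by (simp add: m_def)
  qed
  then have "card E \<le> m"
    using card_mono[of "{1..m}" E] by simp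
  moreover have "fact (card (E - {m})) \<le> \<Prod>(E - {m})"
    using Suc m by (intro Suc.hyps(1)) auto
  moreover have "card (E - {m}) = n" using Suc m by simp
  ultimately have "Suc n * fact n \<le> m * \<Prod>(E - {m})"
    using Suc.hyps(2) by (intro mult_mono) auto
  also have "\<dots> = \<Prod>E"
    using prod.remove[OF Suc.prems(1) m, of "\<lambda>x. x"] by simp
  finally show ?case
    unfolding Suc.hyps(2)[symmetric] by (simp only: fact_Suc of_nat_id)
qed

lemma power_le_fact: "k ^ m \<le> (fact (k + m) :: nat)"
proof (induction m)
  case (Suc m)
  have "k * k ^ m \<le> Suc (k + m) * fact (k + m)"
    using Suc by (intro mult_mono) auto
  then show ?case by simp
qed simp

lemma prod_primes_dvd:
  fixes E :: "nat set"
  assumes "finite E" "\<And>e. e \<in> E \<Longrightarrow> prime e" "\<And>e. e \<in> E \<Longrightarrow> e dvd m"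
  shows "\<Prod>E dvd m"
  using assms
proof (induction E rule: finite_induct)
  case (insert e E)
  have "coprime e (\<Prod>E)"
    using insert by (intro prod_coprime_right primes_coprime) auto
  then show ?case using insert by (simp add: divides_mult)
qed simp

section \<open>Progressions of powers with prime exponents\<close>

locale power_progression =
  fixes A Q g l :: nat and y r :: "nat \<Rightarrow> nat"
  assumes pos: "A > 0" "Q > 0" "g > 0"
    and cop: "coprime A Q"
    and prime_r: "j < l \<Longrightarrow> prime (r j)"
    and power: "j < l \<Longrightarrow> g * (A + j * Q) = y j ^ r j"
begin

lemma exponent_dvd_multiplicity:
  assumes "j < l" "prime p"
  shows "r j dvd multiplicity p g + multiplicity p (A + j * Q)"
proof -
  have "y j ^ r j \<noteq> 0"
    using pos by (simp flip: power[OF assms(1)])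
  then have "y j \<noteq> 0"
    using prime_gt_0_nat[OF prime_r[OF assms(1)]] by (simp add: power_0_left)
  then have "multiplicity p (y j ^ r j) = r j * multiplicity p (y j)"
    using assms(2) by (simp add: prime_elem_multiplicity_power_distrib)
  moreover have "multiplicity p (g * (A + j * Q)) = multiplicity p g + multiplicity p (A + j * Q)"
    using assms(2) pos by (simp add: prime_elem_multiplicity_mult_distrib)
  ultimately have "multiplicity p g + multiplicity p (A + j * Q) = r j * multiplicity p (y j)"
    using power[OF assms(1)] by simp
  then show ?thesis by (rule dvdI)
qed

lemma same_exponent_dvd:
  assumes "i < l" "j < l" "r i = r j" "prime p"
  shows "int (r i) dvd int (multiplicity p (A + i * Q)) - int (multiplicity p (A + j * Q))"
proof -
  have "int (r i) dvd int (multiplicity p g + multiplicity p (A + i * Q))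
      - int (multiplicity p g + multiplicity p (A + j * Q))"
    using exponent_dvd_multiplicity[of i p] exponent_dvd_multiplicity[of j p] assms
    by (intro dvd_diff) (simp_all only: int_dvd_int_iff)
  then show ?thesis by simp
qed

text \<open>Multiplicities in the two terms agree modulo the common exponent, which is at least 2.
  So multiplicity 1 in one term excludes multiplicity 0 in the other, and the prime divides the
  index difference.\<close>

lemma same_exponent_radical:
  assumes "i < l" "j < l" "i \<noteq> j" "r i = r j"
  shows "radical (A + i * Q) ^ 2 \<le> nat \<bar>int i - int j\<bar> * (A + i * Q)"
proof (rule radical_square_le)
  fix p :: nat assume p: "prime p" "multiplicity p (A + i * Q) = 1"
  have "r i > 1" using prime_r[OF assms(1)] prime_gt_1_nat by blast
  have "p dvd A + j * Q"
  proof (rule ccontr)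
    assume "\<not> p dvd A + j * Q"
    then have "multiplicity p (A + j * Q) = 0" by (rule not_dvd_imp_multiplicity_0)
    with same_exponent_dvd[OF assms(1,2,4) p(1)] p(2) \<open>r i > 1\<close> show False by simp
  qed
  moreover have "p dvd A + i * Q"
    using p(2) not_dvd_imp_multiplicity_0[of p "A + i * Q"] by linarith
  ultimately show "p dvd nat \<bar>int i - int j\<bar>"
    using cop p(1) by (intro prime_dvd_progression_diff) auto
qed (use pos assms in auto)

text \<open>Distinct terms differ in multiplicity at some prime \<open>p\<close>. The difference is
  a nonzero multiple of \<open>r i\<close>, so one of the two terms is divisible by
  \<open>p ^ r i\<close>.\<close>

lemma same_exponent_bound:
  assumes "i < l" "j < l" "i \<noteq> j" "r i = r j"
  shows "2 ^ r i \<le> A + l * Q"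
proof -
  have "A + i * Q \<noteq> A + j * Q" using assms(3) pos by simp
  then obtain p where p: "prime p" "multiplicity p (A + i * Q) \<noteq> multiplicity p (A + j * Q)"
    using multiplicity_eq_nat[of "A + i * Q" "A + j * Q"] pos by auto
  have *: "2 ^ r i \<le> A + k * Q" if "multiplicity p (A + k * Q) \<ge> r i" for k
  proof -
    have "2 ^ r i \<le> p ^ r i" using p(1) by (intro power_mono prime_ge_2_nat) auto
    also have "p ^ r i dvd A + k * Q" using that by (rule multiplicity_dvd')
    then have "p ^ r i \<le> A + k * Q" using pos by (intro dvd_imp_le) auto
    finally show ?thesis .
  qed
  have "int (r i) \<le> \<bar>int (multiplicity p (A + i * Q)) - int (multiplicity p (A + j * Q))\<bar>"
    using same_exponent_dvd[OF assms(1,2,4) p(1)] p(2)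
    by (metis dvd_imp_le_int abs_of_nat eq_iff_diff_eq_0 of_nat_eq_iff)
  then have "multiplicity p (A + i * Q) \<ge> r i \<or> multiplicity p (A + j * Q) \<ge> r i"
    by linarith
  then have "2 ^ r i \<le> A + i * Q \<or> 2 ^ r i \<le> A + j * Q" using * by blast
  moreover have "A + i * Q \<le> A + l * Q" "A + j * Q \<le> A + l * Q" using assms by auto
  ultimately show ?thesis by linarith
qed

text \<open>Otherwise \<open>p\<close> divides the terms at some \<open>j < p\<close> and at
  \<open>j + p\<close>. Since \<open>p\<close> does not divide \<open>g\<close>, their
  multiplicities at \<open>p\<close> are multiples of a prime exponent, so \<open>p ^ 2\<close>
  divides both terms and hence \<open>p * Q\<close>.\<close>

lemma small_prime_dvd:
  assumes p: "prime p" "2 * p \<le> l"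
  shows "p dvd g * Q"
proof (rule ccontr)
  assume "\<not> p dvd g * Q"
  then have ng: "\<not> p dvd g" and nQ: "\<not> p dvd Q" by auto
  have not1: "multiplicity p (A + j * Q) \<noteq> 1" if "j < l" for j
  proof
    assume "multiplicity p (A + j * Q) = 1"
    with exponent_dvd_multiplicity[OF that p(1)] not_dvd_imp_multiplicity_0[OF ng]
    have "r j = 1" by simp
    with prime_r[OF that] show False by simp
  qed
  have p2: "p ^ 2 dvd A + j * Q" if "p dvd A + j * Q" "j < l" for j
  proof -
    have "multiplicity p (A + j * Q) \<noteq> 0"
      using that p pos by (simp add: prime_elem_multiplicity_eq_zero_iff)
    with not1[OF that(2)] have "2 \<le> multiplicity p (A + j * Q)" by linarith
    then show ?thesis by (rule multiplicity_dvd')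
  qed
  obtain j where j: "j < p" "p dvd A + j * Q"
  proof -
    have "coprime Q p" using nQ p(1) prime_imp_coprime coprime_commute by blast
    then obtain x where x: "[Q * x = 1] (mod p)" using cong_solve_coprime_nat by auto
    \<comment> \<open>With \<open>x\<close> the inverse of \<open>Q\<close>, this is -A / Q modulo
      \<open>p\<close>; \<open>p - A mod p\<close> represents -A in the natural numbers.\<close>
    define j where "j = ((p - A mod p) * x) mod p"
    have "[A + j * Q = A + (p - A mod p) * x * Q] (mod p)"
      unfolding j_def by (intro cong_add cong_mult cong_refl) simp
    also have "(p - A mod p) * x * Q = (p - A mod p) * (Q * x)"
      by (simp only: mult_ac)
    also have "[A + (p - A mod p) * (Q * x) = A + (p - A mod p) * 1] (mod p)"
      using x by (intro cong_add cong_mult cong_refl)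
    also have "[A + (p - A mod p) * 1 = A mod p + (p - A mod p)] (mod p)"
      by (intro cong_add) simp_all
    also have "A mod p + (p - A mod p) = p"
      using p(1) by (simp add: prime_gt_0_nat less_imp_le)
    also have "[p = 0] (mod p)" by (simp add: cong_0_iff)
    finally have "p dvd A + j * Q" by (simp add: cong_0_iff)
    moreover have "j < p" using p(1) by (simp add: j_def prime_gt_0_nat)
    ultimately show ?thesis using that by blast
  qed
  have "p ^ 2 dvd A + j * Q" using j p(2) by (intro p2) auto
  moreover have eq: "A + (j + p) * Q = (A + j * Q) + p * Q" by (simp add: algebra_simps)
  have "p ^ 2 dvd A + (j + p) * Q"
    using j p(2) by (intro p2) (auto simp: eq)
  ultimately have "p ^ 2 dvd p * Q" unfolding eq by (simp add: dvd_add_right_iff)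
  with nQ p(1) show False by (simp add: power2_eq_square)
qed

text \<open>Outside this set \<open>same_exponent_radical\<close> applies with distance at most
  \<open>H\<close>. Distances between indices are below \<open>l\<close>, so for
  \<open>H = l\<close> the set consists of the indices whose exponent occurs only once.\<close>

definition isolated :: "nat \<Rightarrow> nat set" where
  "isolated H = {i. i < l \<and> (\<forall>j<l. j \<noteq> i \<longrightarrow> r j = r i \<longrightarrow> H < nat \<bar>int i - int j\<bar>)}"

definition repeated :: "nat set" where
  "repeated = {e. \<exists>i j. i < l \<and> j < l \<and> i \<noteq> j \<and> r i = e \<and> r j = e}"

lemma finite_isolated [simp]: "finite (isolated H)"
  by (rule finite_subset[of _ "{..<l}"]) (auto simp: isolated_def)

lemma card_nonrepeated: "card {i. i < l \<and> r i \<notin> repeated} \<le> card (r ` {..<l})"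
  by (rule card_inj_on_le[of r]) (auto simp: inj_on_def repeated_def)

lemma card_isolated_length: "card (isolated l) \<le> card (r ` {..<l})"
proof -
  have "isolated l \<subseteq> {i. i < l \<and> r i \<notin> repeated}"
  proof
    fix i assume "i \<in> isolated l"
    then have i: "i < l" "\<And>j. j < l \<Longrightarrow> j \<noteq> i \<Longrightarrow> r j = r i \<Longrightarrow> l < nat \<bar>int i - int j\<bar>"
      by (auto simp: isolated_def)
    have "j = i" if "j < l" "r j = r i" for j
    proof (rule ccontr)
      assume "j \<noteq> i"
      with i(2)[OF that(1) _ that(2)] that(1) i(1) show False by linarith
    qed
    with i(1) show "i \<in> {i. i < l \<and> r i \<notin> repeated}"
      unfolding repeated_def by (simp, metis)
  qed
  then have "card (isolated l) \<le> card {i. i < l \<and> r i \<notin> repeated}"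
    by (intro card_mono) auto
  with card_nonrepeated show ?thesis by linarith
qed

text \<open>Exponents that occur once account for the first summand. For a repeated exponent, two
  isolated indices cannot lie in the same block of length \<open>H\<close>, so exponent and block
  determine the index.\<close>

lemma card_isolated:
  assumes "H > 0"
  shows "card (isolated H) \<le> card (r ` {..<l}) + card repeated * (l div H + 1)"
proof -
  have fin: "finite repeated"
    by (rule finite_subset[of _ "r ` {..<l}"]) (auto simp: repeated_def)
  let ?I = "{i \<in> isolated H. r i \<in> repeated}"
  have "inj_on (\<lambda>i. (r i, i div H)) ?I"
  proof (rule inj_onI, rule ccontr)
    fix i j assume i: "i \<in> ?I" and j: "j \<in> ?I"
      and eq: "(r i, i div H) = (r j, j div H)" and ne: "i \<noteq> j"
    have "i = H * (j div H) + i mod H" "j = H * (j div H) + j mod H"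
      using eq mult_div_mod_eq[of H i] mult_div_mod_eq[of H j] by simp_all
    moreover have "i mod H < H" "j mod H < H"
      using assms by simp_all
    ultimately have "nat \<bar>int i - int j\<bar> < H" by linarith
    with i j eq ne show False by (auto simp: isolated_def)
  qed
  moreover have "(\<lambda>i. (r i, i div H)) ` ?I \<subseteq> repeated \<times> {..l div H}"
    by (auto simp: isolated_def intro: div_le_mono)
  ultimately have "card ?I \<le> card (repeated \<times> {..l div H})"
    using fin by (intro card_inj_on_le) auto
  moreover have "isolated H \<subseteq> {i. i < l \<and> r i \<notin> repeated} \<union> ?I"
    by (auto simp: isolated_def)
  then have "card (isolated H) \<le> card ({i. i < l \<and> r i \<notin> repeated} \<union> ?I)"
    by (intro card_mono) auto
  moreover note card_Un_le[of "{i. i < l \<and> r i \<notin> repeated}" ?I] card_nonrepeated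
  ultimately show ?thesis by (simp add: card_cartesian_product)
qed

text \<open>Pigeonhole on the \<open>n\<close> disjoint windows of length seven that start at
  \<open>s\<close>.\<close>

lemma window_without_isolated:
  assumes "card (isolated H) < n" "s + 7 * n \<le> l"
  obtains k where "s \<le> k" "k + 7 \<le> l" "\<And>i. i \<le> 6 \<Longrightarrow> k + i \<notin> isolated H"
proof -
  have "\<exists>m<n. \<forall>i\<le>6. s + 7 * m + i \<notin> isolated H"
  proof (rule ccontr)
    assume "\<not> ?thesis"
    then have "\<forall>m\<in>{..<n}. \<exists>i. i \<le> 6 \<and> s + 7 * m + i \<in> isolated H" by auto
    from bchoice[OF this] obtain f
      where f: "\<forall>m\<in>{..<n}. f m \<le> 6 \<and> s + 7 * m + f m \<in> isolated H" by blast
    have "inj_on (\<lambda>m. s + 7 * m + f m) {..<n}"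
    proof (rule inj_onI)
      fix m m' assume "m \<in> {..<n}" "m' \<in> {..<n}" and eq: "s + 7 * m + f m = s + 7 * m' + f m'"
      then have "f m \<le> 6" "f m' \<le> 6" using f by auto
      with eq show "m = m'" by linarith
    qed
    then have "card {..<n} \<le> card (isolated H)"
      by (rule card_inj_on_le) (use f in auto)
    with assms show False by simp
  qed
  then obtain m where "m < n" "\<forall>i\<le>6. s + 7 * m + i \<notin> isolated H" by blast
  with assms show ?thesis by (intro that[of "s + 7 * m"]) auto
qed

text \<open>Where \<open>p\<close> does not divide the term, the exponent divides the multiplicity
  of \<open>p\<close> in \<open>g\<close>. Discarding the other indices leaves at least
  \<open>n\<close> distinct primes, whose product divides that multiplicity.\<close>

lemma many_exponents:
  assumes p: "prime p" "p dvd g"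
    and n: "n + l div p + 1 \<le> card (r ` {..<l})"
  shows "2 ^ fact n \<le> g"
proof -
  let ?D = "{j. j < l \<and> p dvd A + j * Q}"
  define E where "E = r ` {j. j < l \<and> \<not> p dvd A + j * Q}"
  have fin: "finite E" by (simp add: E_def)
  have "r ` {..<l} \<subseteq> E \<union> r ` ?D" by (auto simp: E_def)
  then have "card (r ` {..<l}) \<le> card (E \<union> r ` ?D)"
    using fin by (intro card_mono) auto
  also have "\<dots> \<le> card E + card (r ` ?D)" by (rule card_Un_le)
  also have "card (r ` ?D) \<le> card ?D" by (rule card_image_le) simp
  also have "card ?D \<le> l div p + 1" using cop p(1) by (rule card_prime_dvd_progression)
  finally have "n \<le> card E" using n by simp
  then have "fact n \<le> (fact (card E) :: nat)" by (rule fact_mono_nat)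
  also have "\<dots> \<le> \<Prod>E"
  proof (rule fact_card_le_prod[OF fin])
    show "0 \<notin> E"
    proof
      assume "0 \<in> E"
      then obtain j where "j < l" "r j = 0" by (auto simp: E_def)
      with prime_r[of j] show False by simp
    qed
  qed
  also have "\<dots> \<le> multiplicity p g"
  proof (rule dvd_imp_le)
    show "\<Prod>E dvd multiplicity p g"
    proof (rule prod_primes_dvd[OF fin])
      fix e assume "e \<in> E"
      then obtain j where j: "j < l" "\<not> p dvd A + j * Q" "e = r j" by (auto simp: E_def)
      then show "prime e" using prime_r by simp
      show "e dvd multiplicity p g"
        using exponent_dvd_multiplicity[OF j(1) p(1)] not_dvd_imp_multiplicity_0[OF j(2)] j(3) by simp
    qed
    show "multiplicity p g > 0" using p pos by (simp add: prime_multiplicity_gt_zero_iff)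
  qed
  finally have "2 ^ fact n \<le> (2::nat) ^ multiplicity p g" by (rule power_increasing) simp
  also have "\<dots> \<le> p ^ multiplicity p g"
    using p(1) by (intro power_mono prime_ge_2_nat) auto
  also have "\<dots> \<le> g" using pos by (intro dvd_imp_le multiplicity_dvd) auto
  finally show ?thesis .
qed

end

section \<open>Few exponents, and a gcd with only small prime factors\<close>

locale ABC_power_progression = power_progression +
  fixes K :: real
  assumes K: "K \<ge> 1"
    and five_terms: "\<And>a q M :: nat. a > 0 \<Longrightarrow> q > 0 \<Longrightarrow> coprime a q \<Longrightarrow> M > 0 \<Longrightarrow>
       \<forall>j\<le>6. radical (a + j * q) ^ 2 \<le> M * (a + j * q) \<Longrightarrow>
       real (a + 6 * q) \<le> K * real M ^ 12"
begin

lemma window_bound: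
  assumes "k + 7 \<le> l" "\<And>i. i \<le> 6 \<Longrightarrow> k + i \<notin> isolated H" "H > 0"
  shows "real (A + (k + 6) * Q) \<le> K * real H ^ 12"
proof -
  have "real ((A + k * Q) + 6 * Q) \<le> K * real H ^ 12"
  proof (rule five_terms[rule_format])
    fix i :: nat assume i: "i \<le> 6"
    then have "k + i < l" using assms(1) by simp
    with assms(2)[OF i] obtain j where j: "j < l" "j \<noteq> k + i" "r j = r (k + i)"
      "nat \<bar>int (k + i) - int j\<bar> \<le> H"
      by (auto simp: isolated_def not_less)
    have "radical (A + (k + i) * Q) ^ 2 \<le> nat \<bar>int (k + i) - int j\<bar> * (A + (k + i) * Q)"
      using j \<open>k + i < l\<close> by (intro same_exponent_radical) auto
    also have "\<dots> \<le> H * (A + (k + i) * Q)"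
      using j(4) by (rule mult_right_mono) simp
    finally show "radical (A + k * Q + i * Q) ^ 2 \<le> H * (A + k * Q + i * Q)"
      by (simp add: distrib_right add.assoc)
  qed (use pos assms cop coprime_progression in auto)
  then show ?thesis by (simp add: algebra_simps)
qed

text \<open>The ABC bound is used twice: with \<open>H = l\<close> to make all terms polynomial in
  \<open>l\<close>, then with \<open>H = 100 * m\<close>, where \<open>m\<close> is at most
  \<open>L\<close>. \<open>L1\<close> keeps this \<open>H\<close> below \<open>l\<close>, and
  \<open>L2\<close> contradicts the second bound.\<close>

lemma few_exponents:
  assumes few: "100 * card (r ` {..<l}) < l"
    and large: "l \<ge> 100"
    and L: "L = log 2 (K * real l ^ 13)"
    and L1: "100 * L < real l" and L2: "K * (100 * L) ^ 12 < real l / 2"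
  shows False
proof -
  obtain k where k: "k + 7 \<le> l" "\<And>i. i \<le> 6 \<Longrightarrow> k + i \<notin> isolated l"
  proof (rule window_without_isolated[of l "l div 7" 0])
    show "card (isolated l) < l div 7"
      using card_isolated_length few large by linarith
  qed auto
  \<comment> \<open>The window may lie anywhere; a factor \<open>l\<close> carries its bound to the
    end of the progression.\<close>
  have "A + l * Q \<le> l * (A + (k + 6) * Q)"
  proof -
    have "1 * A \<le> l * A" "l * Q \<le> l * ((k + 6) * Q)" using large by auto
    then show ?thesis by (simp only: distrib_left)
  qed
  then have "real (A + l * Q) \<le> real l * real (A + (k + 6) * Q)"
    by (simp only: of_nat_mult[symmetric] of_nat_le_iff)
  also have "\<dots> \<le> real l * (K * real l ^ 12)"
    using window_bound[OF k] large by (intro mult_left_mono) auto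
  also have "\<dots> = K * real l ^ 13"
    by (simp add: eval_nat_numeral)
  finally have Q: "real (A + l * Q) \<le> K * real l ^ 13" .
  have Lle: "real e \<le> L" if "2 ^ e \<le> A + l * Q" for e
  proof -
    have "(2::real) ^ e \<le> real (A + l * Q)"
      using of_nat_mono[OF that, where ?'a = real] by simp
    with Q have "2 powr real e \<le> K * real l ^ 13"
      by (simp add: powr_realpow)
    moreover have "K * real l ^ 13 > 0" using K large by simp
    ultimately show ?thesis unfolding L by (simp add: le_log_iff)
  qed
  define m where "m = nat \<lfloor>L\<rfloor>"
  have "1 \<le> L"
  proof -
    have "1 * 2 ^ 1 \<le> K * real l ^ 13"
      using K large by (intro mult_mono order.trans[OF power_mono[of 2 "real l" 1] power_increasing[of 1 13 "real l"]]) auto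
    then show ?thesis unfolding L using le_log_iff[of 2 "K * real l ^ 13" 1] by simp
  qed
  then have m: "m \<ge> 1" "real m \<le> L" unfolding m_def by linarith+
  have "repeated \<subseteq> {1..m}"
  proof
    fix e assume "e \<in> repeated"
    then obtain i j where ij: "i < l" "j < l" "i \<noteq> j" "r i = e" "r j = e"
      by (auto simp: repeated_def)
    then have "2 ^ e \<le> A + l * Q" using same_exponent_bound[of i j] by simp
    then have "real e \<le> L" by (rule Lle)
    then have "e \<le> m" unfolding m_def by linarith
    moreover have "e \<ge> 1" using prime_r[of i] ij prime_ge_1_nat by auto
    ultimately show "e \<in> {1..m}" by simp
  qed
  then have rep: "card repeated \<le> m"
    using card_mono[of "{1..m}" repeated] by simp
  \<comment> \<open>The block length 100 * \<open>m\<close> is chosen so that all repeated exponents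
    together give only about l / 100 isolated indices.\<close>
  have "card repeated * (l div (100 * m) + 1) \<le> m * (l div (100 * m) + 1)"
    using rep by (rule mult_right_mono) simp
  also have "\<dots> = m * ((l div 100) div m) + m"
    by (simp add: div_mult2_eq)
  also have "\<dots> \<le> l div 100 + m"
    by simp
  finally have "card (isolated (100 * m)) \<le> card (r ` {..<l}) + l div 100 + m"
    using card_isolated[of "100 * m"] m by linarith
  moreover have "100 * m < l" using m L1 by linarith
  ultimately have few': "card (isolated (100 * m)) < l div 14"
    using few large by linarith
  obtain k where k: "l - 7 * (l div 14) \<le> k" "k + 7 \<le> l"
    "\<And>i. i \<le> 6 \<Longrightarrow> k + i \<notin> isolated (100 * m)"
    by (rule window_without_isolated[OF few', of "l - 7 * (l div 14)"]) auto
  have "l \<le> 2 * k" using k(1) by linarith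
  then have "real l / 2 \<le> real k" by simp
  also have "k * 1 \<le> (k + 6) * Q" using pos by (intro mult_mono) auto
  then have "real k \<le> real (A + (k + 6) * Q)" by (simp only: of_nat_le_iff)
  also have "\<dots> \<le> K * real (100 * m) ^ 12"
    using k m by (intro window_bound) auto
  also have "\<dots> \<le> K * (100 * L) ^ 12"
    using m K by (intro mult_left_mono power_mono) auto
  finally show False using L2 by simp
qed

text \<open>A prime dividing a term exactly once must divide \<open>g\<close>, hence
  \<open>fact B\<close>. So the first seven terms satisfy the ABC bound with
  \<open>M = fact B\<close>, and \<open>Q\<close> is below \<open>P\<close>. But \<open>P\<close>
  does not divide \<open>g\<close>, so a long progression would force it to divide
  \<open>Q\<close>.\<close>

lemma smooth_gcd:
  assumes smooth: "\<And>p. prime p \<Longrightarrow> p dvd g \<Longrightarrow> p \<le> B"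
    and P: "prime P" "P > B" "real P > K * fact B ^ 12"
    and large: "l \<ge> 7"
  shows "l < 2 * P"
proof (rule ccontr)
  assume "\<not> l < 2 * P"
  then have "P dvd g * Q" using P by (intro small_prime_dvd) auto
  moreover have "\<not> P dvd g"
  proof
    assume "P dvd g"
    from smooth[OF P(1) this] P(2) show False by simp
  qed
  ultimately have "P dvd Q" using P(1) by (simp add: prime_dvd_mult_iff)
  then have "P \<le> Q" using pos by (intro dvd_imp_le)
  also have "Q \<le> A + 6 * Q" by simp
  finally have "real P \<le> real (A + 6 * Q)" by (simp only: of_nat_le_iff)
  also have "\<dots> \<le> K * real (fact B) ^ 12"
  proof (rule five_terms[rule_format])
    fix j :: nat assume "j \<le> 6"
    then have j: "j < l" using large by simp
    show "radical (A + j * Q) ^ 2 \<le> fact B * (A + j * Q)"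
    proof (rule radical_square_le)
      fix p :: nat assume p: "prime p" "multiplicity p (A + j * Q) = 1"
      have "p dvd g"
      proof (rule ccontr)
        assume "\<not> p dvd g"
        then have "multiplicity p g = 0" by (rule not_dvd_imp_multiplicity_0)
        with exponent_dvd_multiplicity[OF j p(1)] p(2) have "r j = 1" by simp
        with prime_r[OF j] show False by simp
      qed
      with smooth p(1) show "p dvd fact B"
        by (intro dvd_fact) (auto simp: Suc_le_eq prime_gt_0_nat)
    qed (use pos in auto)
  qed (use pos cop in auto)
  finally show False using P(3) by simp
qed

end

section \<open>Asymptotic estimates\<close>

text \<open>Either \<open>l\<close> is at most sqrt X, which is below X / ln X, or ln l is at least
  half of ln X and can be divided out.\<close>

lemma bounded_by_loglog_quotient:
  fixes X c :: real and l :: nat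
  assumes X: "X > 1" and c: "c > 0" and le: "c * (real l * ln (real l)) \<le> X"
  shows "real l \<le> max 1 (2 / c) * (X / ln X)"
proof (cases "real l \<le> sqrt X")
  case True
  have "ln X = 2 * ln (sqrt X)" using X by (simp add: ln_sqrt)
  also have "\<dots> \<le> 2 * (sqrt X / exp 1)"
    using ln_le_minus_one[of "sqrt X / exp 1"] X by (simp add: ln_div)
  also have "\<dots> \<le> sqrt X"
    using exp_ge_add_one_self[of "1::real"] X by (simp add: field_simps)
  finally have "ln X * sqrt X \<le> sqrt X * sqrt X" using X by (intro mult_right_mono) auto
  then have "sqrt X \<le> 1 * (X / ln X)" using X by (simp add: field_simps)
  also have "\<dots> \<le> max 1 (2 / c) * (X / ln X)" using X by (intro mult_right_mono) auto
  finally show ?thesis using True by linarith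
next
  case False
  then have "ln (sqrt X) \<le> ln (real l)" using X by (intro ln_mono) auto
  then have "ln X / 2 \<le> ln (real l)" using X by (simp add: ln_sqrt)
  then have "c * (real l * (ln X / 2)) \<le> X"
    using c le by (intro order.trans[OF _ le] mult_left_mono) auto
  then have "real l \<le> 2 / c * (X / ln X)" using X c by (simp add: field_simps)
  also have "\<dots> \<le> max 1 (2 / c) * (X / ln X)" using X by (intro mult_right_mono) auto
  finally show ?thesis .
qed

lemma log_power_small:
  assumes "K \<ge> (1::real)"
  obtains N :: nat where "\<And>l. l \<ge> N \<Longrightarrow> 100 * log 2 (K * real l ^ 13) < real l"
    "\<And>l. l \<ge> N \<Longrightarrow> K * (100 * log 2 (K * real l ^ 13)) ^ 12 < real l / 2"
proof -
  have K: "K > 0" using assms by simp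
  have "eventually (\<lambda>l::nat. 100 * log 2 (K * real l ^ 13) < real l) at_top"
    using K by real_asymp
  moreover have "eventually (\<lambda>l::nat. K * (100 * log 2 (K * real l ^ 13)) ^ 12 < real l / 2) at_top"
    using K by real_asymp
  ultimately have "eventually (\<lambda>l::nat. 100 * log 2 (K * real l ^ 13) < real l \<and>
    K * (100 * log 2 (K * real l ^ 13)) ^ 12 < real l / 2) at_top"
    by (rule eventually_conj)
  with that show ?thesis unfolding eventually_at_top_linorder by blast
qed

text \<open>Meant for \<open>k = l div 400\<close>: the logarithm grows like (l / 400) * ln l, so
  the constant 1/1000 leaves room for lower order terms.\<close>

lemma power_self_lower_bound:
  obtains N :: nat where "\<And>l k. l \<ge> N \<Longrightarrow> real k \<ge> real l / 400 - 1 \<Longrightarrow>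
    1 / 1000 * (real l * ln (real l)) \<le> ln (ln 2 * real k ^ k)"
proof -
  have "eventually (\<lambda>l::nat. 1 / 1000 * (real l * ln (real l)) \<le>
     ln (ln 2) + (real l / 400 - 1) * ln (real l / 400 - 1)) at_top"
    by real_asymp
  then obtain N where N: "\<And>l. l \<ge> N \<Longrightarrow> 1 / 1000 * (real l * ln (real l)) \<le>
     ln (ln 2) + (real l / 400 - 1) * ln (real l / 400 - 1)"
    unfolding eventually_at_top_linorder by blast
  show ?thesis
  proof (rule that[of "max N 800"])
    fix l k :: nat assume l: "l \<ge> max N 800" and k: "real k \<ge> real l / 400 - 1"
    have ge1: "real l / 400 - 1 \<ge> 1" using l by simp
    have "1 / 1000 * (real l * ln (real l)) \<le> ln (ln 2) + (real l / 400 - 1) * ln (real l / 400 - 1)"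
      using l by (intro N) simp
    also have "\<dots> \<le> ln (ln 2) + real k * ln (real k)"
      using k ge1 by (intro add_left_mono mult_mono) auto
    also have "\<dots> = ln (ln 2 * real k ^ k)"
      using k ge1 by (simp add: ln_mult ln_realpow)
    finally show "1 / 1000 * (real l * ln (real l)) \<le> ln (ln 2 * real k ^ k)" .
  qed
qed

section \<open>Combination of the cases\<close>

lemma prime_exponent:
  assumes "n \<in> perfect_powers"
  shows "\<exists>r y. prime r \<and> n = y ^ r"
proof -
  from assms obtain x m where x: "n = x ^ m" "m \<ge> 2" by (auto simp: perfect_powers_def)
  then obtain r where r: "prime r" "r dvd m" using prime_factor_nat[of m] by auto
  then have "n = (x ^ (m div r)) ^ r" using x by (simp flip: power_mult)
  with r show ?thesis by blast
qed

theorem theorem2p4: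
  assumes "ABC_conjecture"
  shows "\<exists>C::real. C > 0 \<and>
    (\<forall>a q l::nat. a > 0 \<longrightarrow> q > 0 \<longrightarrow> l > 0 \<longrightarrow>
       {a + j * q | j. 0 \<le> j \<and> j \<le> l - 1} \<subseteq> perfect_powers \<longrightarrow>
       real a > exp (exp 1) \<longrightarrow>
       real l \<le> C * (ln (ln (real a)) / ln (ln (ln (real a)))))"
proof -
  obtain K :: real where K: "K \<ge> 1"
    "\<And>a q M :: nat. a > 0 \<Longrightarrow> q > 0 \<Longrightarrow> coprime a q \<Longrightarrow> M > 0 \<Longrightarrow>
       \<forall>j\<le>6. radical (a + j * q) ^ 2 \<le> M * (a + j * q) \<Longrightarrow>
       real (a + 6 * q) \<le> K * real M ^ 12"
    using ABC_five_terms[OF assms] by blast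
  obtain N1 where N1: "\<And>l. l \<ge> N1 \<Longrightarrow> 100 * log 2 (K * real l ^ 13) < real l"
    "\<And>l. l \<ge> N1 \<Longrightarrow> K * (100 * log 2 (K * real l ^ 13)) ^ 12 < real l / 2"
    using log_power_small[OF K(1)] by blast
  obtain N2 where N2: "\<And>l k. l \<ge> N2 \<Longrightarrow> real k \<ge> real l / 400 - 1 \<Longrightarrow>
    1 / 1000 * (real l * ln (real l)) \<le> ln (ln 2 * real k ^ k)"
    using power_self_lower_bound by blast
  \<comment> \<open>\<open>B\<close> is kept opaque so that the simplifier does not evaluate \<open>fact 1000\<close>.\<close>
  obtain B :: nat where B: "B = 1000" by simp
  obtain P where P: "prime P" "P > max B (nat \<lceil>K * fact B ^ 12\<rceil>)"
    using bigger_prime by blast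
  have P': "P > B" "real P > K * fact B ^ 12" using P(2) by (simp, linarith)
  define N where "N = max (max N1 N2) (max 1000 (2 * P))"
  \<comment> \<open>\<open>real N\<close> covers \<open>l < N\<close>, since X / ln X is at least 1;
    2000 is 2 / (1/1000) from the long case.\<close>
  define C where "C = max 2000 (real N)"
  have "real l \<le> C * (ln (ln (real a)) / ln (ln (ln (real a))))"
    if a: "a > 0" and q: "q > 0" and l: "l > 0"
      and powers: "{a + j * q | j. 0 \<le> j \<and> j \<le> l - 1} \<subseteq> perfect_powers"
      and large: "real a > exp (exp 1)" for a q l :: nat
  proof -
    define X where "X = ln (ln (real a))"
    have "exp 1 < ln (real a)" using large a by (metis exp_less_cancel_iff exp_ln of_nat_0_less_iff)
    then have X: "X > 1" unfolding X_def
      by (metis exp_gt_zero exp_less_cancel_iff exp_ln order.strict_trans)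
    have quot: "1 \<le> X / ln X" using X ln_le_minus_one[of X] by simp
    have "real l \<le> C * (X / ln X)"
    proof (cases "l < N")
      case True
      then have "real l * 1 \<le> C * (X / ln X)"
        using quot by (intro mult_mono) (auto simp: C_def)
      then show ?thesis by simp
    next
      case False
      then have lN: "l \<ge> N1" "l \<ge> N2" "l \<ge> 1000" "l \<ge> 2 * P" by (simp_all add: N_def)
      define g where "g = gcd a q"
      have g: "g > 0" using a by (simp add: g_def)
      obtain A Q where "a = A * g" "q = Q * g" and cop: "coprime A Q"
        using gcd_coprime_exists[of a q] g unfolding g_def by auto
      then have AQ: "a = g * A" "q = g * Q" by simp_all
      have "\<forall>j\<in>{..<l}. \<exists>ry. prime (fst ry) \<and> a + j * q = snd ry ^ fst ry"
      proof
        fix j assume "j \<in> {..<l}"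
        then have "0 \<le> j \<and> j \<le> l - 1" by auto
        then have "a + j * q \<in> perfect_powers" using powers by blast
        from prime_exponent[OF this]
        show "\<exists>ry. prime (fst ry) \<and> a + j * q = snd ry ^ fst ry" by (simp add: split_paired_Ex)
      qed
      from bchoice[OF this] obtain f
        where f: "\<forall>j\<in>{..<l}. prime (fst (f j)) \<and> a + j * q = snd (f j) ^ fst (f j)" by blast
      interpret ABC_power_progression A Q g l "\<lambda>j. snd (f j)" "\<lambda>j. fst (f j)" K
      proof
        fix j assume j: "j < l"
        with f show "prime (fst (f j))" by simp
        have "g * (A + j * Q) = a + j * q" by (simp add: AQ algebra_simps)
        with j f show "g * (A + j * Q) = snd (f j) ^ fst (f j)" by simp
      qed (use a q AQ g cop K in auto)
      let ?R = "(\<lambda>j. fst (f j)) ` {..<l}"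
      have many: "l \<le> 100 * card ?R"
      proof (rule ccontr)
        assume "\<not> ?thesis"
        then show False
          using lN(3) by (intro few_exponents[OF _ _ refl N1[OF lN(1)]]) auto
      qed
      have "\<exists>p. prime p \<and> p dvd g \<and> p > B"
      proof (rule ccontr)
        assume "\<not> ?thesis"
        then have "l < 2 * P"
          using lN(3) by (intro smooth_gcd[OF _ P(1) P']) (auto simp: not_less)
        with lN(4) show False by simp
      qed
      then obtain p where p: "prime p" "p dvd g" "p > B" by blast
      \<comment> \<open>There are at least l / 100 exponents and \<open>p\<close> spoils at most l /
        1000 + 1 indices, so 2 \<open>k\<close> exponents surely remain; twice \<open>k\<close>
        because (2k)! is at least k^k.\<close>
      define k where "k = l div 400"
      have "k + k + l div p + 1 \<le> card ?R"
      proof -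
        have "l div p \<le> l div 1000" using p(3) B by (intro div_le_mono2) auto
        with many lN(3) show ?thesis unfolding k_def by linarith
      qed
      then have "2 ^ fact (k + k) \<le> g" by (rule many_exponents[OF p(1,2)])
      also have "g \<le> a" using AQ(1) a by (intro dvd_imp_le) auto
      finally have "(2::nat) ^ k ^ k \<le> a"
        using power_increasing[OF power_le_fact[of k k], of "2::nat"] by linarith
      then have "2 ^ k ^ k \<le> real a"
        using of_nat_mono[of "2 ^ k ^ k" a, where ?'a = real] by simp
      then have "ln (2 ^ k ^ k) \<le> ln (real a)" using a by simp
      then have "ln 2 * real k ^ k \<le> ln (real a)" by (simp add: ln_realpow mult.commute)
      moreover have k0: "k > 0" using lN(3) by (simp add: k_def)
      ultimately have "ln (ln 2 * real k ^ k) \<le> X" unfolding X_def by (intro ln_mono) auto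
      moreover have "real k \<ge> real l / 400 - 1" unfolding k_def by linarith
      ultimately have "1 / 1000 * (real l * ln (real l)) \<le> X"
        using N2[OF lN(2)] by force
      then have "real l \<le> max 1 (2 / (1 / 1000)) * (X / ln X)"
        using X by (intro bounded_by_loglog_quotient) auto
      also have "\<dots> \<le> C * (X / ln X)"
        using quot by (intro mult_right_mono) (auto simp: C_def)
      finally show ?thesis .
    qed
    then show ?thesis by (simp add: X_def)
  qed
  moreover have "C > 0" by (simp add: C_def)
  ultimately show ?thesis by blast
qed

end
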